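(* Let $H=(V,E)$ be a hypergraph of degree $2$, with maps $i_1,i_2\colon V\to E$ such that $i_1(v)\ne i_2(v)$, $v\in i_1(v)$ and $v\in i_2(v)$ for all $v\in V$. Then $\mathcal{T}_H$ is an ontology of depth $1$ and $H$ is isomorphic to the hypergraph $H^{{\boldsymbol q}_H}_{\mathcal{T}_H}$.
   Context: A hypergraph $H=(V,E)$ is of degree $2$ if every vertex belongs to exactly two hyperedges. For each $e\in E$ take a variable $z_e$ and a unary predicate $A_e$; for each $v\in V$ a binary predicate $R_v$. Define the Boolean CQ ${\boldsymbol q}_H=\exists\vec{z}\bigwedge_{v\in V}R_v(z_{i_1(v)},z_{i_2(v)})$ ($\vec z$ all the $z_e$) and the ontology $\mathcal{T}_H$ consisting of, for each $e\in E$, the tgd $A_e(x)\to\exists y\,\big[\bigwedge_{v\in V,\,i_1(v)=e}R_v(y,x)\land\bigwedge_{v\in V,\,i_2(v)=e}R_v(x,y)\big]$. Ontologies are finite sets of such tgds (unary/binary atoms, no constants, at most two variables). For $\varrho(x)$ of the form $S(x)$, $S(x,x)$, $\exists y\,S(x,y)$ or $\exists y\,S(y,x)$ ($S$ a predicate of $\mathcal{T}$), $\mathcal{C}_\mathcal{T}^{\varrho(a)}$ is the canonical model (chase) of $(\mathcal{T}\cup\{A(x)\to\varrho(x)\},\{A(a)\})$ with $A$ fresh; $\mathcal{T}$ is of depth $k$ if some $\mathcal{C}_\mathcal{T}^{\varrho(a)}$ contains a chain $R_0(w_0,w_1),\dots,R_{k-1}(w_{k-1},w_k)$ (the $w_i$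 not necessarily distinct) but none contains a longer one. For a CQ ${\boldsymbol q}=\exists\vec y\,\varphi$ and disjoint sets of variables $\mathfrak{t}_\mathsf{r},\mathfrak{t}_\mathsf{i}$ with $\emptyset\ne\mathfrak{t}_\mathsf{i}\subseteq\vec{y}$, ${\boldsymbol q}_\mathfrak{t}$ is the set of atoms $S(\vec{z})$ of ${\boldsymbol q}$ with $\vec{z}\subseteq\mathfrak{t}_\mathsf{r}\cup\mathfrak{t}_\mathsf{i}$, $\vec{z}\not\subseteq\mathfrak{t}_\mathsf{r}$; $(\mathfrak{t}_\mathsf{r},\mathfrak{t}_\mathsf{i})$ is a tree witness for ${\boldsymbol q}$ and $\mathcal{T}$ if for some $\varrho$, ${\boldsymbol q}_\mathfrak{t}$ is a minimal subset of ${\boldsymbol q}$ for which there is a homomorphism $h\colon{\boldsymbol q}_\mathfrak{t}\to\mathcal{C}_\mathcal{T}^{\varrho(a)}$ with $\mathfrak{t}_\mathsf{r}=h^{-1}(a)$ and ${\boldsymbol q}_\mathfrak{t}$ contains all atoms with a variable in $\mathfrak{t}_\mathsf{i}$. $H^{\boldsymbol q}_\mathcal{T}$ is the hypergraph with the atoms of ${\boldsymbol q}$ as vertices and the sets ${\boldsymbol q}_\mathfrak{t}$ for tree witnesses $\mathfrak{t}$ as hyperedges. Hypergraphs are isomorphic if there is a bijection between their vertex sets inducing a bijection between their hyperedge sets.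
   Formalization: Chains in the definition of depth have pairwise distinct w_i (with repetitions allowed, R_v(a,a) in the model for R_v(x,x) gives chains of every length, so depth 1 would fail for every H); H is taken finite, with V and all hyperedges nonempty. *)

theory Defs
  imports Main
begin

section \<open>Hypergraphs\<close>

text \<open>
  Hypergraphs are finite, and both the vertex set and every hyperedge are nonempty. For an empty
  hyperedge the variable \<open>z\<^sub>e\<close> would occur in no atom of the query and the head of the tgd for
  \<open>e\<close> would be an empty conjunction; without vertices the ontology below would have no
  binary predicate at all.
\<close>

type_synonym 'v hypergraph = "'v set \<times> 'v set set"

definition hypergraph :: "'v hypergraph \<Rightarrow> bool" where
  "hypergraph = (\<lambda>(V, E). finite V \<and> V \<noteq> {} \<and> E \<subseteq> Pow V \<and> {} \<notin> E)"

definition degree2 :: "'v hypergraph \<Rightarrow> bool" where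
  "degree2 = (\<lambda>(V, E). \<forall>v\<in>V. card {e \<in> E. v \<in> e} = 2)"

definition hypergraph_isomorphic :: "'v hypergraph \<Rightarrow> 'w hypergraph \<Rightarrow> bool" where
  "hypergraph_isomorphic = (\<lambda>(V, E) (V', E').
     \<exists>f. bij_betw f V V' \<and> bij_betw (\<lambda>e. f ` e) E E')"


section \<open>Atoms, tgds, ontologies and conjunctive queries\<close>

datatype (upreds: 'u, bpreds: 'b, args: 't) atom = Unary 'u 't | Binary 'b 't 't

text \<open>
  Tgds have at most two variables and no constants, so their atoms are built over a
  two-element type of variables. A tgd is a pair of body and head; the variables occurring
  only in the head are existentially quantified.
\<close>

datatype tgd_var = X | Y

type_synonym ('u, 'b) tgd = "('u, 'b, tgd_var) atom set \<times> ('u, 'b, tgd_var) atom set"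

definition ontology :: "('u, 'b) tgd set \<Rightarrow> bool" where
  "ontology T \<longleftrightarrow> finite T \<and>
     (\<forall>(body, head)\<in>T. finite body \<and> body \<noteq> {} \<and> finite head \<and> head \<noteq> {})"

definition unary_preds :: "('u, 'b) tgd set \<Rightarrow> 'u set" where
  "unary_preds T = (\<Union>(body, head)\<in>T. \<Union>\<alpha>\<in>body \<union> head. upreds \<alpha>)"

definition binary_preds :: "('u, 'b) tgd set \<Rightarrow> 'b set" where
  "binary_preds T = (\<Union>(body, head)\<in>T. \<Union>\<alpha>\<in>body \<union> head. bpreds \<alpha>)"

record ('u, 'b, 'x) cq =
  evars :: "'x set"
  atoms :: "('u, 'b, 'x) atom set"


section \<open>The chase\<close>

text \<open>
  The (oblivious) chase: a tgd is applied once to every match of its body. The null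
  \<open>Null \<tau> y m\<close> is the one invented for the existential variable \<open>y\<close> of \<open>\<tau>\<close> when \<open>\<tau>\<close> is applied
  to the match \<open>m\<close> of its body variables.
\<close>

datatype (dead 'u, dead 'b, 'c) elem =
  Ind 'c | Null "('u, 'b) tgd" tgd_var "tgd_var \<Rightarrow> ('u, 'b, 'c) elem option"

definition body_vars :: "('u, 'b) tgd \<Rightarrow> tgd_var set" where
  "body_vars \<tau> = (\<Union>\<alpha>\<in>fst \<tau>. args \<alpha>)"

definition extend_match ::
  "('u, 'b) tgd \<Rightarrow> (tgd_var \<Rightarrow> ('u, 'b, 'c) elem) \<Rightarrow> tgd_var \<Rightarrow> ('u, 'b, 'c) elem" where
  "extend_match \<tau> h z =
     (if z \<in> body_vars \<tau> then h z
      else Null \<tau> z (\<lambda>u. if u \<in> body_vars \<tau> then Some (h u) else None))"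

inductive_set chase ::
  "('u, 'b) tgd set \<Rightarrow> ('u, 'b, 'c) atom set \<Rightarrow> ('u, 'b, ('u, 'b, 'c) elem) atom set"
  for T :: "('u, 'b) tgd set" and D :: "('u, 'b, 'c) atom set" where
  data: "\<alpha> \<in> D \<Longrightarrow> map_atom id id Ind \<alpha> \<in> chase T D"
| step: "\<tau> \<in> T \<Longrightarrow> (\<And>\<beta>. \<beta> \<in> fst \<tau> \<Longrightarrow> map_atom id id h \<beta> \<in> chase T D) \<Longrightarrow> \<alpha> \<in> snd \<tau>
    \<Longrightarrow> map_atom id id (extend_match \<tau> h) \<alpha> \<in> chase T D"

text \<open>
  The formulas \<open>S(x)\<close>, \<open>S(x,x)\<close>, \<open>\<exists>y S(x,y)\<close> and \<open>\<exists>y S(y,x)\<close>. The fresh unary predicate \<open>A\<close>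
  is \<open>None\<close>; the unary predicates of the given ontology are embedded by \<open>Some\<close>.
\<close>

datatype ('u, 'b) gen = Concept 'u | Loop 'b | Out 'b | In 'b

definition gens :: "('u, 'b) tgd set \<Rightarrow> ('u, 'b) gen set" where
  "gens T = Concept ` unary_preds T \<union> Loop ` binary_preds T
     \<union> Out ` binary_preds T \<union> In ` binary_preds T"

fun gen_head :: "('u, 'b) gen \<Rightarrow> ('u option, 'b, tgd_var) atom" where
  "gen_head (Concept S) = Unary (Some S) X"
| "gen_head (Loop S) = Binary S X X"
| "gen_head (Out S) = Binary S X Y"
| "gen_head (In S) = Binary S Y X"

definition gen_tgd :: "('u, 'b) gen \<Rightarrow> ('u option, 'b) tgd" where
  "gen_tgd \<rho> = ({Unary None X}, {gen_head \<rho>})"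

definition embed_tgd :: "('u, 'b) tgd \<Rightarrow> ('u option, 'b) tgd" where
  "embed_tgd = (\<lambda>(body, head). (map_atom Some id id ` body, map_atom Some id id ` head))"

type_synonym ('u, 'b) celem = "('u option, 'b, unit) elem"

abbreviation root :: "('u, 'b) celem" where
  "root \<equiv> Ind ()"

definition canonical ::
  "('u, 'b) tgd set \<Rightarrow> ('u, 'b) gen \<Rightarrow> ('u option, 'b, ('u, 'b) celem) atom set" where
  "canonical T \<rho> = chase (embed_tgd ` T \<union> {gen_tgd \<rho>}) {Unary None ()}"


section \<open>Depth of an ontology\<close>

text \<open>
  Chains must not revisit an element. With repetitions no ontology having a binary predicate \<open>S\<close>
  would have finite depth, because the canonical model generated by \<open>S(x,x)\<close> contains
  the loop \<open>S(a,a)\<close>: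
\<close>

lemma loop_in_canonical: "Binary S root root \<in> canonical T (Loop S)"
proof -
  let ?T = "embed_tgd ` T \<union> {gen_tgd (Loop S)}"
  have "map_atom id id Ind (Unary None ()) \<in> chase ?T {Unary None ()}"
    by (rule chase.data) simp
  then have "map_atom id id (extend_match (gen_tgd (Loop S)) (\<lambda>_. root)) (Binary S X X)
      \<in> chase ?T {Unary None ()}"
    by (intro chase.step) (auto simp: gen_tgd_def)
  then show ?thesis
    by (simp add: canonical_def extend_match_def body_vars_def gen_tgd_def)
qed

definition has_chain :: "('u, 'b, 'd) atom set \<Rightarrow> nat \<Rightarrow> bool" where
  "has_chain C k \<longleftrightarrow>
     (\<exists>w. inj_on w {..k} \<and> (\<forall>i<k. \<exists>R. Binary R (w i) (w (Suc i)) \<in> C))"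

definition of_depth :: "('u, 'b) tgd set \<Rightarrow> nat \<Rightarrow> bool" where
  "of_depth T k \<longleftrightarrow>
     (\<exists>\<rho>\<in>gens T. has_chain (canonical T \<rho>) k) \<and>
     (\<forall>\<rho>\<in>gens T. \<forall>m>k. \<not> has_chain (canonical T \<rho>) m)"


section \<open>Tree witnesses\<close>

definition tw_atoms ::
  "('u, 'b, 'x) cq \<Rightarrow> 'x set \<times> 'x set \<Rightarrow> ('u, 'b, 'x) atom set" where
  "tw_atoms q = (\<lambda>(tr, ti). {\<alpha> \<in> atoms q. args \<alpha> \<subseteq> tr \<union> ti \<and> \<not> args \<alpha> \<subseteq> tr})"

definition hom_to_canonical ::
  "('u, 'b) tgd set \<Rightarrow> ('u, 'b) gen \<Rightarrow> ('u, 'b, 'x) atom set \<Rightarrow> ('x \<Rightarrow> ('u, 'b) celem) \<Rightarrow> bool" where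
  "hom_to_canonical T \<rho> p h \<longleftrightarrow> (\<forall>\<alpha>\<in>p. map_atom Some id h \<alpha> \<in> canonical T \<rho>)"

text \<open>
  All requirements on a tree witness generated by \<open>\<rho>\<close> except minimality. A homomorphism is
  defined on the variables of its atoms only, hence the form of the preimage of the root.
\<close>

definition tw_candidate ::
  "('u, 'b, 'x) cq \<Rightarrow> ('u, 'b) tgd set \<Rightarrow> ('u, 'b) gen \<Rightarrow> 'x set \<times> 'x set \<Rightarrow> bool" where
  "tw_candidate q T \<rho> = (\<lambda>(tr, ti).
     tr \<inter> ti = {} \<and> ti \<noteq> {} \<and> ti \<subseteq> evars q \<and>
     (\<exists>h. hom_to_canonical T \<rho> (tw_atoms q (tr, ti)) h \<and>
          tr = {z \<in> \<Union> (args ` tw_atoms q (tr, ti)). h z = root}) \<and>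
     {\<alpha> \<in> atoms q. args \<alpha> \<inter> ti \<noteq> {}} \<subseteq> tw_atoms q (tr, ti))"

text \<open>
  Minimality compares the atom sets of all candidate pairs for the same \<open>\<rho>\<close>; for a fixed pair
  the last condition of a candidate already determines the set of atoms.
\<close>

definition tree_witness ::
  "('u, 'b, 'x) cq \<Rightarrow> ('u, 'b) tgd set \<Rightarrow> 'x set \<times> 'x set \<Rightarrow> bool" where
  "tree_witness q T t \<longleftrightarrow>
     (\<exists>\<rho>\<in>gens T. tw_candidate q T \<rho> t \<and>
        \<not> (\<exists>t'. tw_candidate q T \<rho> t' \<and> tw_atoms q t' \<subset> tw_atoms q t))"

definition tw_hypergraph ::
  "('u, 'b, 'x) cq \<Rightarrow> ('u, 'b) tgd set \<Rightarrow> ('u, 'b, 'x) atom hypergraph" where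
  "tw_hypergraph q T = (atoms q, {tw_atoms q t | t. tree_witness q T t})"


section \<open>The query and the ontology of a hypergraph of degree 2\<close>

text \<open>
  The variable \<open>z\<^sub>e\<close> and the unary predicate \<open>A\<^sub>e\<close> are represented by the hyperedge \<open>e\<close>,
  the binary predicate \<open>R\<^sub>v\<close> by the vertex \<open>v\<close>.
\<close>

definition hg_query ::
  "'v hypergraph \<Rightarrow> ('v \<Rightarrow> 'v set) \<Rightarrow> ('v \<Rightarrow> 'v set) \<Rightarrow> ('v set, 'v, 'v set) cq" where
  "hg_query = (\<lambda>(V, E) i1 i2. \<lparr>evars = E, atoms = {Binary v (i1 v) (i2 v) | v. v \<in> V}\<rparr>)"

definition hg_ontology ::
  "'v hypergraph \<Rightarrow> ('v \<Rightarrow> 'v set) \<Rightarrow> ('v \<Rightarrow> 'v set) \<Rightarrow> ('v set, 'v) tgd set" where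
  "hg_ontology = (\<lambda>(V, E) i1 i2.
     {({Unary e X}, {Binary v Y X | v. v \<in> V \<and> i1 v = e} \<union> {Binary v X Y | v. v \<in> V \<and> i2 v = e})
      | e. e \<in> E})"

end

theory Submission
  imports Defs
begin

text \<open>
  No head of \<open>\<T>\<^sub>H\<close> contains a unary atom, so a canonical model of \<open>\<T>\<^sub>H\<close> consists of the root \<open>a\<close>
  and at most one null \<open>y\<close>, whence depth 1. A tree witness must send every variable
  \<open>z\<^sub>e \<in> \<tt>\<^sub>i\<close>, together with all its atoms \<open>R\<^sub>v\<close>, \<open>v \<in> e\<close>, to atoms joining \<open>a\<close> and \<open>y\<close>, with \<open>z\<^sub>e\<close>
  sent to \<open>y\<close>. In the model generated by \<open>A\<^sub>e\<close> the orientation of these atoms forces \<open>\<tt>\<^sub>i = {z\<^sub>e}\<close>;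
  the models generated by \<open>\<exists>y R\<^sub>v(x,y)\<close> and \<open>\<exists>y R\<^sub>v(y,x)\<close> only yield \<open>e = {v}\<close>, and those generated
  by \<open>R\<^sub>v(x,x)\<close> yield nothing. So the sets \<open>q\<^sub>\<tt>\<close> are exactly the hyperedges.
\<close>

section \<open>Canonical models as least closed sets\<close>

text \<open>Chase induction with the generating tgd separated from those of the ontology; this is
  the tool for bounding canonical models from above.\<close>

lemma canonical_subsetI:
  assumes "Unary None root \<in> S"
    and "\<And>h. Unary None (h X) \<in> S \<Longrightarrow>
      map_atom id id (extend_match (gen_tgd \<rho>) h) (gen_head \<rho>) \<in> S"
    and "\<And>\<tau> h \<alpha>. \<tau> \<in> embed_tgd ` T \<Longrightarrow> (\<And>\<beta>. \<beta> \<in> fst \<tau> \<Longrightarrow> map_atom id id h \<beta> \<in> S)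
      \<Longrightarrow> \<alpha> \<in> snd \<tau> \<Longrightarrow> map_atom id id (extend_match \<tau> h) \<alpha> \<in> S"
  shows "canonical T \<rho> \<subseteq> S"
proof
  fix \<alpha> assume "\<alpha> \<in> canonical T \<rho>"
  then show "\<alpha> \<in> S"
    unfolding canonical_def
  proof (induction rule: chase.induct)
    case (data \<alpha>)
    then show ?case using assms(1) by simp
  next
    case (step \<tau> h \<alpha>)
    show ?case
    proof (cases "\<tau> = gen_tgd \<rho>")
      case True
      then have "Unary None (h X) \<in> S" "\<alpha> = gen_head \<rho>"
        using step.IH[of "Unary None X"] step.hyps by (auto simp: gen_tgd_def)
      then show ?thesis using assms(2) True by simp
    next
      case False
      then show ?thesis using step assms(3) by blast
    qed
  qed
qed

lemma root_in_canonical: "Unary None root \<in> canonical T \<rho>"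
  unfolding canonical_def using chase.data[of "Unary None ()" "{Unary None ()}"] by simp

lemma canonical_step:
  assumes "\<tau> \<in> embed_tgd ` T \<union> {gen_tgd \<rho>}"
    and "\<And>\<beta>. \<beta> \<in> fst \<tau> \<Longrightarrow> map_atom id id h \<beta> \<in> canonical T \<rho>" and "\<alpha> \<in> snd \<tau>"
  shows "map_atom id id (extend_match \<tau> h) \<alpha> \<in> canonical T \<rho>"
  using assms unfolding canonical_def by (rule chase.step)

lemma concept_in_canonical: "Unary (Some S) root \<in> canonical T (Concept S)"
  using canonical_step[of "gen_tgd (Concept S)" T "Concept S" "\<lambda>_. root" "Unary (Some S) X"]
  by (simp add: gen_tgd_def extend_match_def body_vars_def root_in_canonical)

section \<open>Degree-2 hypergraphs and their ontology\<close>

locale degree2_hypergraph =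
  fixes V :: "'v set" and E :: "'v set set" and i1 i2 :: "'v \<Rightarrow> 'v set"
  assumes hyp: "hypergraph (V, E)"
    and deg: "degree2 (V, E)"
    and ends_in: "v \<in> V \<Longrightarrow> i1 v \<in> E" "v \<in> V \<Longrightarrow> i2 v \<in> E"
    and ends_neq: "v \<in> V \<Longrightarrow> i1 v \<noteq> i2 v"
    and in_ends: "v \<in> V \<Longrightarrow> v \<in> i1 v" "v \<in> V \<Longrightarrow> v \<in> i2 v"
begin

abbreviation "T \<equiv> hg_ontology (V, E) i1 i2"
abbreviation "q \<equiv> hg_query (V, E) i1 i2"
abbreviation "vertex_atom v \<equiv> Binary v (i1 v) (i2 v) :: ('v set, 'v, 'v set) atom"

definition edge_tgd :: "'v set \<Rightarrow> ('v set option, 'v) tgd" where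
  "edge_tgd e = ({Unary (Some e) X},
     {Binary v Y X | v. v \<in> V \<and> i1 v = e} \<union> {Binary v X Y | v. v \<in> V \<and> i2 v = e})"

text \<open>The null that the chase invents when \<open>edge_tgd e\<close> is applied at
  \<open>root\<close>; the recorded match is undefined at \<open>Y\<close>, which is not a body
  variable.\<close>

definition edge_null :: "'v set \<Rightarrow> ('v set, 'v) celem" where
  "edge_null e = Null (edge_tgd e) Y [X \<mapsto> root]"

lemma edge_subset: "e \<in> E \<Longrightarrow> e \<subseteq> V" and edge_nonempty: "e \<in> E \<Longrightarrow> e \<noteq> {}"
  and finite_V: "finite V" and V_nonempty: "V \<noteq> {}"
  using hyp by (auto simp: hypergraph_def)

lemma finite_E: "finite E"
  using hyp by (auto simp: hypergraph_def intro: finite_subset)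

text \<open>By degree 2, exactly two hyperedges contain \<open>v\<close>; the distinct
  \<open>i1 v\<close> and \<open>i2 v\<close> are two such, hence all of them.\<close>

lemma edge_iff:
  assumes "v \<in> V" "e \<in> E"
  shows "v \<in> e \<longleftrightarrow> e = i1 v \<or> e = i2 v"
proof -
  have "card {e \<in> E. v \<in> e} = 2" using deg assms by (auto simp: degree2_def)
  moreover have "{i1 v, i2 v} \<subseteq> {e \<in> E. v \<in> e}" using ends_in in_ends assms by auto
  moreover have "card {i1 v, i2 v} = 2" using ends_neq assms by simp
  ultimately have "{i1 v, i2 v} = {e \<in> E. v \<in> e}"
    using finite_E by (intro card_subset_eq) auto
  then show ?thesis using assms by blast
qed

lemma edge_cases:
  assumes "e \<in> E" "v \<in> e"
  obtains "e = i1 v" | "e = i2 v"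
  using assms edge_iff edge_subset by blast

lemma embed_hg_ontology: "embed_tgd ` T = edge_tgd ` E"
proof -
  have "T = (\<lambda>e. ({Unary e X}, {Binary v Y X | v. v \<in> V \<and> i1 v = e}
      \<union> {Binary v X Y | v. v \<in> V \<and> i2 v = e})) ` E"
    by (auto simp: hg_ontology_def)
  \<comment> \<open>Head atoms are binary, so embedding the unary predicates by \<open>Some\<close>
    changes only their type.\<close>
  moreover have "map_atom (Some :: 'v set \<Rightarrow> _) id id ` {Binary v y x | v. v \<in> V \<and> P v}
      = {Binary v y x | v. v \<in> V \<and> P v}" for x y :: tgd_var and P
    by force
  ultimately show ?thesis
    by (simp add: image_image embed_tgd_def edge_tgd_def image_Un)
qed

lemma ontology_hg: "ontology T"
  unfolding ontology_def
proof (intro conjI)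
  show "finite T" using finite_E by (simp add: hg_ontology_def)
  \<comment> \<open>Any vertex of the nonempty \<open>e\<close> contributes an atom to the head of
    the tgd for \<open>e\<close>.\<close>
  have "\<exists>v\<in>V. i1 v = e \<or> i2 v = e" if "e \<in> E" for e
    using that edge_nonempty[of e] edge_subset[of e] edge_iff[of _ e] by blast
  then show "\<forall>(body, head)\<in>T. finite body \<and> body \<noteq> {} \<and> finite head \<and> head \<noteq> {}"
    using finite_V by (fastforce simp: hg_ontology_def)
qed

lemma unary_preds_hg: "unary_preds T = E"
  by (auto simp: unary_preds_def hg_ontology_def)

lemma binary_preds_hg: "binary_preds T = V"
proof
  show "binary_preds T \<subseteq> V" by (auto simp: binary_preds_def hg_ontology_def)
  show "V \<subseteq> binary_preds T"
  proof
    fix v assume v: "v \<in> V"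
    let ?head = "{Binary u Y X | u. u \<in> V \<and> i1 u = i1 v} \<union> {Binary u X Y | u. u \<in> V \<and> i2 u = i1 v}"
    have "({Unary (i1 v) X}, ?head) \<in> T" using v ends_in by (auto simp: hg_ontology_def)
    moreover have "Binary v Y X \<in> ?head" using v by blast
    ultimately show "v \<in> binary_preds T"
      unfolding binary_preds_def by (intro UN_I[of "({Unary (i1 v) X}, ?head)"]) auto
  qed
qed

section \<open>The canonical models\<close>

text \<open>The generating tgd supplies the only atom that can match the body of an ontology tgd, so
  of these only \<open>edge_tgd e\<close> fires, and only at \<open>root\<close>; its binary head
  triggers nothing further.\<close>

lemma canonical_concept:
  assumes "e \<in> E"
  shows "canonical T (Concept e) = {Unary None root, Unary (Some e) root}
    \<union> {Binary v (edge_null e) root | v. v \<in> V \<and> i1 v = e}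
    \<union> {Binary v root (edge_null e) | v. v \<in> V \<and> i2 v = e}" (is "_ = ?S")
proof
  show "canonical T (Concept e) \<subseteq> ?S"
  proof (rule canonical_subsetI)
    fix \<tau> h \<alpha>
    assume \<tau>: "\<tau> \<in> embed_tgd ` T" and body: "\<And>\<beta>. \<beta> \<in> fst \<tau> \<Longrightarrow> map_atom id id h \<beta> \<in> ?S"
      and \<alpha>: "\<alpha> \<in> snd \<tau>"
    then obtain e' where e': "e' \<in> E" "\<tau> = edge_tgd e'" by (auto simp: embed_hg_ontology)
    with body[of "Unary (Some e') X"] have "e' = e" "h X = root" by (auto simp: edge_tgd_def)
    \<comment> \<open>\<open>h\<close> is arbitrary at \<open>Y\<close>, but a null records only the
      values at body variables, so every match yields the same null.\<close>
    moreover from this have "extend_match \<tau> h Y = edge_null e" "extend_match \<tau> h X = root"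
      using e' by (auto simp: extend_match_def body_vars_def edge_null_def edge_tgd_def fun_eq_iff)
    ultimately show "map_atom id id (extend_match \<tau> h) \<alpha> \<in> ?S"
      using \<alpha> e' by (auto simp: edge_tgd_def)
  qed (auto simp: extend_match_def body_vars_def gen_tgd_def)
  let ?h = "extend_match (edge_tgd e) (\<lambda>_. root)"
  have "?h Y = edge_null e" "?h X = root"
    by (auto simp: extend_match_def body_vars_def edge_null_def edge_tgd_def fun_eq_iff)
  moreover have "map_atom id id ?h \<alpha> \<in> canonical T (Concept e)" if "\<alpha> \<in> snd (edge_tgd e)" for \<alpha>
    using that assms concept_in_canonical
    by (intro canonical_step) (auto simp: embed_hg_ontology edge_tgd_def)
  from this[of "Binary _ Y X"] this[of "Binary _ X Y"]
  have "v \<in> V \<Longrightarrow> i1 v = e \<Longrightarrow> Binary v (?h Y) (?h X) \<in> canonical T (Concept e)"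
    and "v \<in> V \<Longrightarrow> i2 v = e \<Longrightarrow> Binary v (?h X) (?h Y) \<in> canonical T (Concept e)" for v
    by (auto simp: edge_tgd_def)
  ultimately show "?S \<subseteq> canonical T (Concept e)"
    using root_in_canonical concept_in_canonical by auto
qed

text \<open>The generating tgd produces a binary atom, so nothing matches the body of an ontology
  tgd; the generating tgd itself fires only at \<open>root\<close>.\<close>

lemma canonical_binary_subset:
  assumes "\<rho> = Loop v \<or> \<rho> = Out v \<or> \<rho> = In v"
  shows "canonical T \<rho> \<subseteq> {Unary None root,
    map_atom id id (extend_match (gen_tgd \<rho>) (\<lambda>_. root)) (gen_head \<rho>)}" (is "_ \<subseteq> ?S")
proof (rule canonical_subsetI)
  fix h assume "Unary None (h X) \<in> ?S"
  then have "h X = root" using assms by auto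
  then have "extend_match (gen_tgd \<rho>) h = extend_match (gen_tgd \<rho>) (\<lambda>_. root)"
    by (auto simp: extend_match_def body_vars_def gen_tgd_def fun_eq_iff)
  then show "map_atom id id (extend_match (gen_tgd \<rho>) h) (gen_head \<rho>) \<in> ?S" by simp
next
  fix \<tau> h \<alpha>
  assume "\<tau> \<in> embed_tgd ` T" and body: "\<And>\<beta>. \<beta> \<in> fst \<tau> \<Longrightarrow> map_atom id id h \<beta> \<in> ?S"
  then obtain e' where "\<tau> = edge_tgd e'" by (auto simp: embed_hg_ontology)
  with body[of "Unary (Some e') X"] assms have False by (auto simp: edge_tgd_def)
  then show "map_atom id id (extend_match \<tau> h) \<alpha> \<in> ?S" ..
qed simp

text \<open>Inclusions suffice for the binary generators: chains and homomorphisms in their models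
  are only restricted, never constructed.\<close>

lemma canonical_gen_cases:
  assumes "\<rho> \<in> gens T"
  obtains (Concept) e where "e \<in> E" "\<rho> = Concept e"
  | (Loop) v where "\<rho> = Loop v" "canonical T \<rho> \<subseteq> {Unary None root, Binary v root root}"
  | (Out) v y where "v \<in> V" "\<rho> = Out v" "y \<noteq> root"
      "canonical T \<rho> \<subseteq> {Unary None root, Binary v root y}"
  | (In) v y where "v \<in> V" "\<rho> = In v" "y \<noteq> root"
      "canonical T \<rho> \<subseteq> {Unary None root, Binary v y root}"
proof -
  let ?y = "extend_match (gen_tgd \<rho>) (\<lambda>_. root) Y"
  have ext: "extend_match (gen_tgd \<rho>) (\<lambda>_. root) X = root" "?y \<noteq> root"
    by (auto simp: extend_match_def body_vars_def gen_tgd_def)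
  from assms consider e where "e \<in> E" "\<rho> = Concept e" | v where "\<rho> = Loop v"
    | v where "v \<in> V" "\<rho> = Out v" | v where "v \<in> V" "\<rho> = In v"
    by (auto simp: gens_def unary_preds_hg binary_preds_hg)
  then show thesis
  proof cases
    case 1
    then show ?thesis by (rule that(1))
  next
    case (2 v)
    with canonical_binary_subset[of \<rho> v] ext show ?thesis by (intro that(2)[of v]) auto
  next
    case (3 v)
    with canonical_binary_subset[of \<rho> v] ext show ?thesis by (intro that(3)[of v ?y]) auto
  next
    case (4 v)
    with canonical_binary_subset[of \<rho> v] ext show ?thesis by (intro that(4)[of v ?y]) auto
  qed
qed

lemma edge_null_neq_root [simp]: "edge_null e \<noteq> root" "root \<noteq> edge_null e"
  by (simp_all add: edge_null_def)

section \<open>Depth\<close>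

lemma canonical_two_elements:
  assumes "\<rho> \<in> gens T"
  obtains y where "\<And>R s t. Binary R s t \<in> canonical T \<rho> \<Longrightarrow> {s, t} \<subseteq> {root, y}"
  using assms
proof (cases rule: canonical_gen_cases)
  case (Concept e)
  then show ?thesis by (intro that[of "edge_null e"]) (auto simp: canonical_concept)
next
  case (Loop v)
  then show ?thesis by (intro that[of root]) auto
next
  case (Out v y)
  then show ?thesis by (intro that[of y]) auto
next
  case (In v y)
  then show ?thesis by (intro that[of y]) auto
qed

lemma depth_hg: "of_depth T 1"
  unfolding of_depth_def
proof (intro conjI ballI allI impI notI)
  obtain v where v: "v \<in> V" using V_nonempty by blast
  \<comment> \<open>In the tgd for \<open>i2 v\<close> the atom with predicate \<open>v\<close>
    points from \<open>X\<close> to \<open>Y\<close>, hence from \<open>root\<close> to the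
    null.\<close>
  let ?e = "i2 v"
  have "has_chain (canonical T (Concept ?e)) 1"
    unfolding has_chain_def using v ends_in
    by (intro exI[of _ "\<lambda>i. if i = 0 then root else edge_null ?e"])
       (auto simp: canonical_concept inj_on_def)
  then show "\<exists>\<rho>\<in>gens T. has_chain (canonical T \<rho>) 1"
    using v ends_in by (auto simp: gens_def unary_preds_hg)
next
  fix \<rho> and m :: nat
  assume \<rho>: "\<rho> \<in> gens T" and m: "1 < m" and "has_chain (canonical T \<rho>) m"
  then obtain w where inj: "inj_on w {..m}"
    and w: "\<And>i. i < m \<Longrightarrow> \<exists>R. Binary R (w i) (w (Suc i)) \<in> canonical T \<rho>"
    by (auto simp: has_chain_def)
  obtain y where y: "\<And>R s t. Binary R s t \<in> canonical T \<rho> \<Longrightarrow> {s, t} \<subseteq> {root, y}"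
    using canonical_two_elements[OF \<rho>] by metis
  have "{w 0, w 1} \<subseteq> {root, y}" "{w 1, w 2} \<subseteq> {root, y}"
    using w[of 0] w[of 1] y m by (auto simp: numeral_2_eq_2)
  \<comment> \<open>Pigeonhole: three distinct elements of the chain would lie in a set of size at
    most two.\<close>
  then have "w ` {0, 1, 2} \<subseteq> {root, y}" by auto
  then have "card (w ` {0, 1, 2}) \<le> card {root, y}" by (intro card_mono) auto
  also have "\<dots> \<le> 2" by (simp add: card_insert_if)
  finally show False
    using card_image[OF inj_on_subset[OF inj, of "{0, 1, 2}"]] m by simp
qed

section \<open>Tree witnesses\<close>

lemma atoms_q: "atoms q = vertex_atom ` V" and evars_q: "evars q = E"
  by (auto simp: hg_query_def)

lemma tw_atoms_q:
  "tw_atoms q (tr, ti) = vertex_atom `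
     {v \<in> V. {i1 v, i2 v} \<subseteq> tr \<union> ti \<and> \<not> {i1 v, i2 v} \<subseteq> tr}"
  by (auto simp: tw_atoms_def atoms_q)

text \<open>Every atom of a hyperedge in \<open>ti\<close> belongs to the tree-witness atoms and is
  therefore mapped by \<open>h\<close>. As hyperedges are nonempty, each \<open>e\<close> in
  \<open>ti\<close> occurs in such an atom, so \<open>h e = root\<close> would put \<open>e\<close>
  into \<open>tr\<close>, which is disjoint from \<open>ti\<close>.\<close>

lemma tw_candidateE:
  assumes "tw_candidate q T \<rho> (tr, ti)"
  obtains h where "ti \<subseteq> E" "ti \<noteq> {}"
    "\<And>e v. e \<in> ti \<Longrightarrow> v \<in> e \<Longrightarrow> Binary v (h (i1 v)) (h (i2 v)) \<in> canonical T \<rho>"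
    "\<And>e. e \<in> ti \<Longrightarrow> h e \<noteq> root"
    "\<And>e v. e \<in> ti \<Longrightarrow> v \<in> e \<Longrightarrow> vertex_atom v \<in> tw_atoms q (tr, ti)"
proof -
  note cand = assms[unfolded tw_candidate_def prod.case evars_q]
  from cand have tri: "tr \<inter> ti = {}" "ti \<noteq> {}" "ti \<subseteq> E"
    and all: "{\<alpha> \<in> atoms q. args \<alpha> \<inter> ti \<noteq> {}} \<subseteq> tw_atoms q (tr, ti)"
    by iprover+
  from cand have "\<exists>h. hom_to_canonical T \<rho> (tw_atoms q (tr, ti)) h \<and>
      tr = {z \<in> \<Union> (args ` tw_atoms q (tr, ti)). h z = root}"
    by iprover
  then obtain h where h: "hom_to_canonical T \<rho> (tw_atoms q (tr, ti)) h \<and>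
      tr = {z \<in> \<Union> (args ` tw_atoms q (tr, ti)). h z = root}" ..
  note tr = h[THEN conjunct2]
  have hom: "map_atom Some id h \<alpha> \<in> canonical T \<rho>" if "\<alpha> \<in> tw_atoms q (tr, ti)" for \<alpha>
    using h[THEN conjunct1] that unfolding hom_to_canonical_def by blast
  have mem: "vertex_atom v \<in> tw_atoms q (tr, ti)" if "e \<in> ti" "v \<in> e" for e v
  proof -
    have "v \<in> V" "e = i1 v \<or> e = i2 v" using that tri edge_subset edge_iff by blast+
    then have "vertex_atom v \<in> {\<alpha> \<in> atoms q. args \<alpha> \<inter> ti \<noteq> {}}"
      using that by (auto simp: atoms_q)
    then show ?thesis using all by blast
  qed
  have "h e \<noteq> root" if e: "e \<in> ti" for e
  proof
    assume "h e = root"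
    obtain v where "v \<in> e" using e tri edge_nonempty by blast
    with e tri have "e \<in> args (vertex_atom v)" by (auto elim: edge_cases)
    with mem[OF e \<open>v \<in> e\<close>] \<open>h e = root\<close> tr have "e \<in> tr" by blast
    then show False using e tri by blast
  qed
  moreover have "Binary v (h (i1 v)) (h (i2 v)) \<in> canonical T \<rho>" if "e \<in> ti" "v \<in> e" for e v
    using hom[OF mem[OF that]] by simp
  ultimately show thesis using that tri mem by blast
qed

text \<open>Each atom of \<open>tw_atoms q (tr, ti)\<close> has an argument outside
  \<open>tr\<close>, necessarily \<open>e\<close>, so its vertex lies in \<open>e\<close>; the
  second assumption gives the other inclusion.\<close>

lemma tw_atoms_singleton:
  assumes "ti = {e}"
    and "\<And>v. v \<in> e \<Longrightarrow> vertex_atom v \<in> tw_atoms q (tr, ti)"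
  shows "tw_atoms q (tr, ti) = vertex_atom ` e"
proof
  show "tw_atoms q (tr, ti) \<subseteq> vertex_atom ` e"
    using assms(1) in_ends by (auto simp: tw_atoms_q)
  show "vertex_atom ` e \<subseteq> tw_atoms q (tr, ti)"
    using assms(2) by blast
qed

text \<open>Orientation forces \<open>ti = {e}\<close>. If \<open>e'\<close> in \<open>ti\<close> is
  \<open>i1 v\<close>, the image of the atom of \<open>v\<close> does not start at
  \<open>root\<close>; such atoms of the model start at the null and satisfy
  \<open>i1 v = e\<close>. The case of \<open>i2 v\<close> is symmetric.\<close>

lemma tw_candidate_concept_atoms:
  assumes e: "e \<in> E" and cand: "tw_candidate q T (Concept e) (tr, ti)"
  shows "tw_atoms q (tr, ti) = vertex_atom ` e"
  using cand
proof (cases rule: tw_candidateE)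
  case (1 h)
  have "e' = e" if e': "e' \<in> ti" for e'
  proof -
    obtain v where v: "v \<in> e'" using e' 1(1) edge_nonempty by blast
    have "e' \<in> E" using e' 1(1) by blast
    then show ?thesis
      using v 1(3)[OF e' v] 1(4)[OF e'] e
      by (elim edge_cases[of e' v]) (auto simp: canonical_concept)
  qed
  with 1(2) have "ti = {e}" by blast
  with 1(5)[of e] show ?thesis by (intro tw_atoms_singleton) simp_all
qed

lemma tw_candidate_atoms:
  assumes "\<rho> \<in> gens T" and cand: "tw_candidate q T \<rho> (tr, ti)"
  obtains e where "e \<in> E" "tw_atoms q (tr, ti) = vertex_atom ` e"
  using cand
proof (cases rule: tw_candidateE)
  case (1 h)
  have singleton: "tw_atoms q (tr, ti) = vertex_atom ` e0"
    if e0: "\<And>e. e \<in> ti \<Longrightarrow> e = e0" for e0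
  proof -
    from e0 1(2) have "ti = {e0}" by blast
    with 1(5)[of e0] show ?thesis by (intro tw_atoms_singleton) simp_all
  qed
  from assms(1) show ?thesis
  proof (cases rule: canonical_gen_cases)
    case (Concept e)
    then show ?thesis using that tw_candidate_concept_atoms cand by blast
  next
    case (Loop v)
    \<comment> \<open>The atom of \<open>u\<close> would be sent to a loop at \<open>root\<close>,
      although \<open>h e\<close> is not \<open>root\<close>.\<close>
    obtain e u where "e \<in> ti" "u \<in> e" using 1(1,2) edge_nonempty by blast
    then show ?thesis using 1(1) 1(3)[of e u] 1(4)[of e] Loop by (auto elim: edge_cases)
  next
    case (Out v y)
    \<comment> \<open>The single binary atom forces \<open>u = v\<close> and sends
      \<open>i1 v\<close> to \<open>root\<close>, so \<open>e\<close> must be the other end. The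
      case of \<open>In\<close> is the mirror image.\<close>
    have "e = i2 v" if e: "e \<in> ti" for e
    proof -
      obtain u where "u \<in> e" using e 1(1) edge_nonempty by blast
      then show ?thesis using 1(1) e 1(3)[of e u] 1(4)[of e] Out by (auto elim: edge_cases)
    qed
    with Out show ?thesis by (intro that[of "i2 v"] singleton ends_in)
  next
    case (In v y)
    have "e = i1 v" if e: "e \<in> ti" for e
    proof -
      obtain u where "u \<in> e" using e 1(1) edge_nonempty by blast
      then show ?thesis using 1(1) e 1(3)[of e u] 1(4)[of e] In by (auto elim: edge_cases)
    qed
    with In show ?thesis by (intro that[of "i1 v"] singleton ends_in)
  qed
qed

lemma tree_witness_edge:
  assumes e: "e \<in> E"
  obtains t where "tree_witness q T t" "tw_atoms q t = vertex_atom ` e"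
proof -
  \<comment> \<open>The other ends of the atoms of \<open>e\<close>, which the homomorphism sends to
    \<open>root\<close> while \<open>e\<close> goes to the null.\<close>
  define tr where "tr = (i1 ` e \<union> i2 ` e) - {e}"
  have atoms: "tw_atoms q (tr, {e}) = vertex_atom ` e"
    using e edge_subset[OF e] edge_iff[of _ e]
    by (intro tw_atoms_singleton) (fastforce simp: tr_def tw_atoms_q)+
  let ?h = "\<lambda>z. if z = e then edge_null e else root"
  have "hom_to_canonical T (Concept e) (tw_atoms q (tr, {e})) ?h"
    unfolding hom_to_canonical_def atoms
  proof (intro ballI)
    fix \<alpha> assume "\<alpha> \<in> vertex_atom ` e"
    then obtain v where v: "v \<in> e" "\<alpha> = vertex_atom v" by blast
    then have "v \<in> V" using e edge_subset by blast
    \<comment> \<open>As \<open>i1 v\<close> and \<open>i2 v\<close> differ, exactly one end of the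
      atom is sent to the null, on the side prescribed by the tgd for \<open>e\<close>.\<close>
    from e v(1) show "map_atom Some id ?h \<alpha> \<in> canonical T (Concept e)"
      unfolding canonical_concept[OF e]
      using \<open>v \<in> V\<close> ends_neq[of v] ends_neq[of v, symmetric]
      by (elim edge_cases[of e v]) (simp_all add: v(2))
  qed
  moreover have "tr = {z \<in> \<Union> (args ` tw_atoms q (tr, {e})). ?h z = root}"
    unfolding atoms by (auto simp: tr_def)
  moreover have "{\<alpha> \<in> atoms q. args \<alpha> \<inter> {e} \<noteq> {}} \<subseteq> tw_atoms q (tr, {e})"
    unfolding atoms using in_ends by (auto simp: atoms_q)
  ultimately have cand: "tw_candidate q T (Concept e) (tr, {e})"
    using e unfolding tw_candidate_def by (auto simp: evars_q tr_def)
  \<comment> \<open>Minimality: all candidates generated by \<open>Concept e\<close> have the same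
    atom set, so none is strictly smaller.\<close>
  have "tree_witness q T (tr, {e})"
    unfolding tree_witness_def
    using cand atoms tw_candidate_concept_atoms[OF e] e
    by (intro bexI[of _ "Concept e"]) (auto simp: gens_def unary_preds_hg)
  then show thesis using that atoms by blast
qed

section \<open>The isomorphism\<close>

lemma hypergraph_isomorphic_hg: "hypergraph_isomorphic (V, E) (tw_hypergraph q T)"
proof -
  \<comment> \<open>The predicate of an atom determines its vertex; injectivity on the whole type
    also makes the image map on hyperedges injective.\<close>
  have inj: "inj vertex_atom" by (auto simp: inj_def)
  have "{tw_atoms q t | t. tree_witness q T t} = (\<lambda>e. vertex_atom ` e) ` E"
  proof (intro equalityI subsetI)
    fix p assume "p \<in> {tw_atoms q t | t. tree_witness q T t}"
    then obtain \<rho> tr ti where "\<rho> \<in> gens T" "tw_candidate q T \<rho> (tr, ti)" "p = tw_atoms q (tr, ti)"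
      by (auto simp: tree_witness_def)
    then show "p \<in> (\<lambda>e. vertex_atom ` e) ` E" by (auto elim: tw_candidate_atoms)
  next
    fix p assume "p \<in> (\<lambda>e. vertex_atom ` e) ` E"
    then obtain e where "e \<in> E" "p = vertex_atom ` e" by blast
    moreover from this obtain t where "tree_witness q T t" "tw_atoms q t = vertex_atom ` e"
      by (elim tree_witness_edge)
    ultimately show "p \<in> {tw_atoms q t | t. tree_witness q T t}"
      by blast
  qed
  then have "bij_betw (\<lambda>e. vertex_atom ` e) E {tw_atoms q t | t. tree_witness q T t}"
    using inj by (auto simp: bij_betw_def inj_on_def inj_image_eq_iff)
  moreover have "bij_betw vertex_atom V (atoms q)"
    using inj by (auto simp: bij_betw_def atoms_q intro: inj_on_subset)
  ultimately show ?thesis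
    by (auto simp: hypergraph_isomorphic_def tw_hypergraph_def)
qed

end

theorem theorem10:
  fixes V :: "'v set" and E :: "'v set set" and i1 i2 :: "'v \<Rightarrow> 'v set"
  assumes "hypergraph (V, E)"
    and "degree2 (V, E)"
    and "\<forall>v\<in>V. i1 v \<in> E \<and> i2 v \<in> E"
    and "\<forall>v\<in>V. i1 v \<noteq> i2 v \<and> v \<in> i1 v \<and> v \<in> i2 v"
  shows "ontology (hg_ontology (V, E) i1 i2)
    \<and> of_depth (hg_ontology (V, E) i1 i2) 1
    \<and> hypergraph_isomorphic (V, E)
        (tw_hypergraph (hg_query (V, E) i1 i2) (hg_ontology (V, E) i1 i2))"
proof -
  interpret degree2_hypergraph V E i1 i2
    using assms by unfold_locales auto
  show ?thesis
    using ontology_hg depth_hg hypergraph_isomorphic_hg by blast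
qed

end
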